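(* Suppose that the complete bipartite graph $G_0=(A_0\cup B_0,E_0)$ with $|A_0|=a$ and $|B_0|=b$ is not $(k_A,k_B)$-choosable. Then every bipartite graph $G=(A\cup B,E)$ with parts $A$ and $B$ such that $|A|\le|B|$ and every vertex of $B$ has degree at least $\delta_B$, where $\delta_B>4ab\log(4a)\log k_A$, is not $(k_A,k_B)$-choosable.
   Context: $\log$ is the natural logarithm. For a bipartite graph $G=(A\cup B,E)$ with designated parts $A,B$, a $(k_A,k_B)$-list-assignment assigns to each vertex of $A$ a set of $k_A$ positive integers and to each vertex of $B$ a set of $k_B$ positive integers; $G$ is $(k_A,k_B)$-choosable if for every such assignment $L$ there is a proper colouring $c$ with $c(v)\in L(v)$ for all $v$.
   Formalization: The formal theorem assumes k_A ≥ 2 and that G has at least one vertex; for k_A = 1 the claim fails (K_{2,1} is not (1,2)-choosable but K_{1,1} is, with δ_B = 1 > 0), for k_A = 0 log k_A is undefined, and the empty graph is choosable. *)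

theory Defs
  imports Complex_Main
begin

text \<open>A finite simple bipartite graph is given by its two designated parts and its set of edges,
  an edge being the unordered pair of its end points. Either part may be empty.\<close>

definition bipartite_edges :: "'v set \<Rightarrow> 'v set \<Rightarrow> 'v set set" where
  "bipartite_edges A B = {{u, v} | u v. u \<in> A \<and> v \<in> B}"

definition bipartite_graph :: "'v set \<Rightarrow> 'v set \<Rightarrow> 'v set set \<Rightarrow> bool" where
  "bipartite_graph A B E \<longleftrightarrow>
     finite A \<and> finite B \<and> A \<inter> B = {} \<and> E \<subseteq> bipartite_edges A B"

definition complete_bipartite_graph :: "'v set \<Rightarrow> 'v set \<Rightarrow> 'v set set \<Rightarrow> bool" where
  "complete_bipartite_graph A B E \<longleftrightarrow> bipartite_graph A B E \<and> E = bipartite_edges A B"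

definition degree :: "'v set set \<Rightarrow> 'v \<Rightarrow> nat" where
  "degree E v = card {e \<in> E. v \<in> e}"

text \<open>The finiteness condition is needed because \<^term>\<open>card\<close> is 0 on infinite sets.\<close>

definition colour_list :: "nat \<Rightarrow> nat set \<Rightarrow> bool" where
  "colour_list k S \<longleftrightarrow> S \<subseteq> {0<..} \<and> finite S \<and> card S = k"

definition list_assignment ::
    "'v set \<Rightarrow> 'v set \<Rightarrow> nat \<Rightarrow> nat \<Rightarrow> ('v \<Rightarrow> nat set) \<Rightarrow> bool" where
  "list_assignment A B kA kB L \<longleftrightarrow>
     (\<forall>v\<in>A. colour_list kA (L v)) \<and> (\<forall>v\<in>B. colour_list kB (L v))"

definition proper_colouring :: "'v set set \<Rightarrow> ('v \<Rightarrow> nat) \<Rightarrow> bool" where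
  "proper_colouring E c \<longleftrightarrow> (\<forall>u v. {u, v} \<in> E \<longrightarrow> c u \<noteq> c v)"

definition choosable :: "'v set \<Rightarrow> 'v set \<Rightarrow> 'v set set \<Rightarrow> nat \<Rightarrow> nat \<Rightarrow> bool" where
  "choosable A B E kA kB \<longleftrightarrow>
     (\<forall>L. list_assignment A B kA kB L \<longrightarrow>
        (\<exists>c. proper_colouring E c \<and> (\<forall>v\<in>A \<union> B. c v \<in> L v)))"

end

theory Submission
  imports Defs "HOL-Library.FuncSet"
begin

text \<open>Give every vertex of \<open>A\<close> independently a random label: each \<open>x \<in> A0\<close> with probability \<open>p / a\<close>,
  no label with probability \<open>1 - p\<close>, where \<open>p = 1 / (4 b log kA)\<close>. A vertex labelled \<open>x\<close> receives the
  bad list of \<open>x\<close>. Call \<open>w \<in> B\<close> good if its neighbours carry all the labels; the degree condition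
  makes \<open>w\<close> bad with probability below \<open>1/4\<close>. Only \<open>p |A|\<close> vertices are labelled on average, so for
  some labelling the number of colourings of the labelled vertices is less than
  \<open>exp (g / b)\<close>, with \<open>g\<close> the number of good vertices. For each colouring of the
  labelled vertices and each good \<open>w\<close>, the list of at least one of the \<open>b\<close> vertices of \<open>B0\<close>, when
  given to \<open>w\<close>, blocks the colouring. Choosing these lists greedily leaves at most a
  proportion \<open>(1 - 1/b)^g \<le> exp (- g / b)\<close> of the colourings, hence none.

  Averages over random labellings are weighted sums over \<open>A \<rightarrow>\<^sub>E Y\<close>.\<close>

section \<open>Product-weighted averages over labellings\<close>

definition labelling_mean ::
    "'v set \<Rightarrow> 'y set \<Rightarrow> ('y \<Rightarrow> real) \<Rightarrow> (('v \<Rightarrow> 'y) \<Rightarrow> real) \<Rightarrow> real" where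
  "labelling_mean A Y q F = (\<Sum>f\<in>A \<rightarrow>\<^sub>E Y. (\<Prod>v\<in>A. q (f v)) * F f)"

lemma labelling_mean_add:
  "labelling_mean A Y q (\<lambda>f. F f + G f) = labelling_mean A Y q F + labelling_mean A Y q G"
  by (simp add: labelling_mean_def distrib_left sum.distrib)

lemma labelling_mean_cmult:
  "labelling_mean A Y q (\<lambda>f. c * F f) = c * labelling_mean A Y q F"
  by (simp add: labelling_mean_def sum_distrib_left mult_ac)

lemma labelling_mean_sum:
  "labelling_mean A Y q (\<lambda>f. \<Sum>j\<in>J. F j f) = (\<Sum>j\<in>J. labelling_mean A Y q (F j))"
  unfolding labelling_mean_def sum_distrib_left by (rule sum.swap)

text \<open>Independence of the labels: by distributivity the weighted sum over all labellings
  splits into one factor per vertex.\<close>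

lemma labelling_mean_prod:
  assumes "finite A" "finite Y"
  shows "labelling_mean A Y q (\<lambda>f. \<Prod>v\<in>A. k v (f v)) = (\<Prod>v\<in>A. \<Sum>y\<in>Y. q y * k v y)"
  using assms by (simp add: labelling_mean_def prod_sum_PiE flip: prod.distrib)

text \<open>Each vertex outside \<open>N\<close> contributes the total weight 1, so only the factors
  of \<open>N\<close> remain.\<close>

lemma labelling_mean_prod_subset:
  assumes "finite A" "finite Y" "(\<Sum>y\<in>Y. q y) = 1" "N \<subseteq> A"
  shows "labelling_mean A Y q (\<lambda>f. \<Prod>v\<in>N. h (f v)) = (\<Sum>y\<in>Y. q y * h y) ^ card N"
proof -
  have *: "(\<Prod>v\<in>N. g v) = (\<Prod>v\<in>A. if v \<in> N then g v else 1)" for g :: "'a \<Rightarrow> real"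
    using assms by (simp add: prod.If_cases Int_absorb1)
  have "labelling_mean A Y q (\<lambda>f. \<Prod>v\<in>N. h (f v))
      = labelling_mean A Y q (\<lambda>f. \<Prod>v\<in>A. (\<lambda>v y. if v \<in> N then h y else 1) v (f v))"
    by (simp add: *)
  also have "\<dots> = (\<Prod>v\<in>A. \<Sum>y\<in>Y. q y * (if v \<in> N then h y else 1))"
    by (rule labelling_mean_prod[OF assms(1,2)])
  also have "\<dots> = (\<Prod>v\<in>A. if v \<in> N then (\<Sum>y\<in>Y. q y * h y) else 1)"
    using assms(3) by (intro prod.cong) auto
  also have "\<dots> = (\<Sum>y\<in>Y. q y * h y) ^ card N"
    by (simp flip: *)
  finally show ?thesis .
qed

lemma labelling_mean_const:
  assumes "finite A" "finite Y" "(\<Sum>y\<in>Y. q y) = 1"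
  shows "labelling_mean A Y q (\<lambda>f. c) = c"
  using labelling_mean_prod_subset[OF assms, of "{}" "\<lambda>_. 1"]
    labelling_mean_cmult[of A Y q c "\<lambda>_. 1"] by simp

text \<open>First-moment principle: the mean is a convex combination of the values, so it cannot lie
  below all of them.\<close>

lemma ex_le_labelling_mean:
  assumes "finite A" "finite Y" "(\<Sum>y\<in>Y. q y) = 1" "\<And>y. y \<in> Y \<Longrightarrow> 0 \<le> q y"
  shows "\<exists>f\<in>A \<rightarrow>\<^sub>E Y. F f \<le> labelling_mean A Y q F"
proof (rule ccontr)
  define m where "m = labelling_mean A Y q F"
  define W where "W f = (\<Prod>v\<in>A. q (f v))" for f
  assume "\<not> ?thesis"
  then have gt: "m < F f" if "f \<in> A \<rightarrow>\<^sub>E Y" for f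
    using that by (auto simp: m_def not_le)
  have W: "0 \<le> W f" if "f \<in> A \<rightarrow>\<^sub>E Y" for f
    unfolding W_def using that assms(4) by (intro prod_nonneg) auto
  have fin: "finite (A \<rightarrow>\<^sub>E Y)"
    using assms by (intro finite_PiE)
  have "(\<Sum>f\<in>A \<rightarrow>\<^sub>E Y. W f) = 1"
    using labelling_mean_const[OF assms(1-3), of 1] by (simp add: labelling_mean_def W_def)
  \<comment> \<open>Strictness survives the summation only at a labelling of nonzero weight; one
    exists because the weights sum to 1.\<close>
  then have "\<exists>f\<in>A \<rightarrow>\<^sub>E Y. W f \<noteq> 0"
    by (metis sum.neutral zero_neq_one)
  then obtain g where g: "g \<in> A \<rightarrow>\<^sub>E Y" "W g \<noteq> 0"
    by blast
  have "labelling_mean A Y q (\<lambda>_. m) < labelling_mean A Y q F"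
    unfolding labelling_mean_def W_def[symmetric]
  proof (rule sum_strict_mono_ex1[OF fin])
    show "\<forall>f\<in>A \<rightarrow>\<^sub>E Y. W f * m \<le> W f * F f"
      by (intro ballI mult_left_mono less_imp_le[OF gt] W)
    show "\<exists>f\<in>A \<rightarrow>\<^sub>E Y. W f * m < W f * F f"
      using W[of g] g gt[of g] by (intro bexI[of _ g]) (auto intro!: mult_strict_left_mono)
  qed
  then show False
    by (simp add: labelling_mean_const[OF assms(1-3)] m_def)
qed

text \<open>Both counts enter one linear combination so that a single labelling controls them
  together. The number of labelled vertices has mean exactly \<open>p * card A\<close>, whatever the
  sign of \<open>s\<close>; the vertices missing a label are estimated by a union bound over the
  labels, hence \<open>0 \<le> r\<close>.\<close>

lemma ex_partial_labelling:
  fixes s p r :: real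
  assumes "finite A" "finite B" "finite X" "X \<noteq> {}" "\<And>w. w \<in> B \<Longrightarrow> N w \<subseteq> A"
    and "0 \<le> p" "p \<le> 1" "0 \<le> r"
  shows "\<exists>f\<in>A \<rightarrow>\<^sub>E insert None (Some ` X).
      s * card {v \<in> A. f v \<noteq> None} + r * card {w \<in> B. \<exists>x\<in>X. \<forall>v\<in>N w. f v \<noteq> Some x}
      \<le> s * (p * card A) + r * (\<Sum>w\<in>B. card X * (1 - p / card X) ^ card (N w))"
proof -
  define Y where "Y = insert None (Some ` X)"
  define q where "q y = (if y = None then 1 - p else p / card X)" for y :: "'c option"
  \<comment> \<open>Indicators are written as products, the first over a singleton, so that
    \<open>labelling_mean_prod_subset\<close> evaluates both terms.\<close>
  define F where "F f = s * (\<Sum>v\<in>A. \<Prod>u\<in>{v}. of_bool (f u \<noteq> None))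
      + r * (\<Sum>w\<in>B. \<Sum>x\<in>X. \<Prod>v\<in>N w. of_bool (f v \<noteq> Some x))" for f :: "'a \<Rightarrow> 'c option"
  have Y: "finite Y"
    using assms by (simp add: Y_def)
  have sumY: "(\<Sum>y\<in>Y. g y) = g None + (\<Sum>x\<in>X. g (Some x))" for g :: "'c option \<Rightarrow> real"
    unfolding Y_def using assms by (subst sum.insert) (auto simp: sum.reindex)
  have X: "card X \<noteq> 0"
    using assms by simp
  have q1: "(\<Sum>y\<in>Y. q y) = 1"
    using X by (simp add: sumY q_def)
  have labelled: "(\<Sum>y\<in>Y. q y * of_bool (y \<noteq> None)) = p"
    using X by (simp add: sumY q_def)
  have avoid: "(\<Sum>y\<in>Y. q y * of_bool (y \<noteq> Some x)) = 1 - p / card X" if "x \<in> X" for x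
  proof -
    have "(\<Sum>z\<in>X. q (Some z) * of_bool (z \<noteq> x)) = (\<Sum>z\<in>X - {x}. p / card X)"
      using assms(3) by (intro sum.mono_neutral_cong_right) (auto simp: q_def)
    also have "\<dots> = p - p / card X"
      using that X by (simp add: of_nat_diff Suc_le_eq field_simps)
    finally show ?thesis
      by (simp add: sumY q_def)
  qed
  have "0 \<le> q y" for y
    using assms(6,7) by (simp add: q_def)
  then obtain f where f: "f \<in> A \<rightarrow>\<^sub>E Y" "F f \<le> labelling_mean A Y q F"
    using ex_le_labelling_mean[OF assms(1) Y q1] by blast
  have m1: "labelling_mean A Y q (\<lambda>f. \<Prod>u\<in>{v}. of_bool (f u \<noteq> None)) = p" if "v \<in> A" for v
    using labelling_mean_prod_subset[OF assms(1) Y q1, of "{v}" "\<lambda>y. of_bool (y \<noteq> None)"] that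
    by (simp add: labelled del: not_None_eq)
  have m2: "labelling_mean A Y q (\<lambda>f. \<Prod>v\<in>N w. of_bool (f v \<noteq> Some x))
      = (1 - p / card X) ^ card (N w)" if "w \<in> B" "x \<in> X" for w x
    using labelling_mean_prod_subset[OF assms(1) Y q1, of "N w" "\<lambda>y. of_bool (y \<noteq> Some x)"]
      assms(5) that
    by (simp add: avoid)
  have mean: "labelling_mean A Y q F
      = s * (p * card A) + r * (\<Sum>w\<in>B. card X * (1 - p / card X) ^ card (N w))"
    unfolding F_def labelling_mean_add labelling_mean_cmult labelling_mean_sum
    using m1 m2 by (simp add: mult_ac)
  have "real (card {v \<in> A. f v \<noteq> None}) = (\<Sum>v\<in>A. \<Prod>u\<in>{v}. of_bool (f u \<noteq> None))"
    using assms(1) by (simp add: Int_def)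
  moreover have "real (card {w \<in> B. \<exists>x\<in>X. \<forall>v\<in>N w. f v \<noteq> Some x})
      \<le> (\<Sum>w\<in>B. \<Sum>x\<in>X. \<Prod>v\<in>N w. of_bool (f v \<noteq> Some x))"
  proof -
    have "of_bool (\<exists>x\<in>X. \<forall>v\<in>N w. f v \<noteq> Some x)
        \<le> (\<Sum>x\<in>X. \<Prod>v\<in>N w. of_bool (f v \<noteq> Some x) :: real)" for w
    proof (cases "\<exists>x\<in>X. \<forall>v\<in>N w. f v \<noteq> Some x")
      case True
      then obtain x where x: "x \<in> X" "\<forall>v\<in>N w. f v \<noteq> Some x"
        by blast
      have "(\<Prod>v\<in>N w. of_bool (f v \<noteq> Some x) :: real)
          \<le> (\<Sum>x\<in>X. \<Prod>v\<in>N w. of_bool (f v \<noteq> Some x))"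
        using x(1) assms(3) by (intro member_le_sum prod_nonneg) auto
      with x show ?thesis
        by auto
    qed (auto intro!: sum_nonneg prod_nonneg)
    then have "(\<Sum>w\<in>B. of_bool (\<exists>x\<in>X. \<forall>v\<in>N w. f v \<noteq> Some x))
        \<le> (\<Sum>w\<in>B. \<Sum>x\<in>X. \<Prod>v\<in>N w. of_bool (f v \<noteq> Some x) :: real)"
      by (intro sum_mono)
    then show ?thesis
      using assms(2) by (simp add: Int_def)
  qed
  ultimately have "s * card {v \<in> A. f v \<noteq> None}
      + r * card {w \<in> B. \<exists>x\<in>X. \<forall>v\<in>N w. f v \<noteq> Some x} \<le> F f"
    unfolding F_def using assms(8) by (simp add: mult_left_mono)
  also note f(2)
  also note mean
  finally show ?thesis
    using f(1) unfolding Y_def by (rule bexI)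
qed

section \<open>Greedy elimination of colourings\<close>

text \<open>At each new point the survivors are covered by the sets that the single \<open>y\<close>
  kill, so some \<open>y\<close> kills at least the average share \<open>1 / card Y\<close> of
  them.\<close>

lemma greedy_cover:
  fixes K :: "'c \<Rightarrow> 'w \<Rightarrow> 'y \<Rightarrow> bool"
  assumes "finite W" "finite C" "finite Y" "Y \<noteq> {}"
    and "\<And>c w. c \<in> C \<Longrightarrow> w \<in> W \<Longrightarrow> \<exists>y\<in>Y. K c w y"
  shows "\<exists>g\<in>W \<rightarrow> Y. real (card {c \<in> C. \<forall>w\<in>W. \<not> K c w (g w)})
      \<le> (1 - 1 / card Y) ^ card W * card C"
  using assms(1,5)
proof (induction W rule: finite_induct)
  case empty
  show ?case by simp
next
  case (insert w W)
  then obtain g where g: "g \<in> W \<rightarrow> Y" "real (card {c \<in> C. \<forall>w\<in>W. \<not> K c w (g w)})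
      \<le> (1 - 1 / card Y) ^ card W * card C"
    by auto
  define D where "D = {c \<in> C. \<forall>w\<in>W. \<not> K c w (g w)}"
  define k where "k y = card {c \<in> D. K c w y}" for y
  have D: "finite D" "D \<subseteq> C"
    using assms(2) by (auto simp: D_def)
  have Y: "0 < card Y"
    using assms by (simp add: card_gt_0_iff)
  have "D \<subseteq> (\<Union>y\<in>Y. {c \<in> D. K c w y})"
    using insert.prems D(2) by fastforce
  then have "card D \<le> card (\<Union>y\<in>Y. {c \<in> D. K c w y})"
    using D(1) assms(3) by (intro card_mono) auto
  also have "\<dots> \<le> (\<Sum>y\<in>Y. k y)"
    unfolding k_def by (rule card_UN_le[OF assms(3)])
  finally have le: "real (card D) \<le> (\<Sum>y\<in>Y. real (k y))"
    by (simp flip: of_nat_sum)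
  obtain y where y: "y \<in> Y" "card D / card Y \<le> k y"
  proof (rule ccontr)
    assume "\<not> thesis"
    then have "real (k y) < card D / card Y" if "y \<in> Y" for y
      using that \<open>\<And>y. y \<in> Y \<Longrightarrow> card D / card Y \<le> k y \<Longrightarrow> thesis\<close> not_le by blast
    then have "(\<Sum>y\<in>Y. real (k y)) < (\<Sum>y\<in>Y. card D / card Y)"
      using assms(3,4) by (intro sum_strict_mono) auto
    with le Y show False
      by simp
  qed
  define g' where "g' = g(w := y)"
  have "{c \<in> C. \<forall>v\<in>insert w W. \<not> K c v (g' v)} = D - {c \<in> D. K c w y}"
    using insert.hyps(2) by (auto simp: D_def g'_def)
  then have "real (card {c \<in> C. \<forall>v\<in>insert w W. \<not> K c v (g' v)}) = real (card D) - k y"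
    using D(1) by (simp add: card_Diff_subset k_def of_nat_diff card_mono)
  also have "\<dots> \<le> (1 - 1 / card Y) * card D"
    using y(2) by (simp add: algebra_simps)
  also have "\<dots> \<le> (1 - 1 / card Y) * ((1 - 1 / card Y) ^ card W * card C)"
    using g(2) Y by (intro mult_left_mono) (auto simp: D_def)
  finally have "real (card {c \<in> C. \<forall>v\<in>insert w W. \<not> K c v (g' v)})
      \<le> (1 - 1 / card Y) ^ card (insert w W) * card C"
    using insert.hyps by (simp add: mult.assoc)
  moreover have "g' \<in> insert w W \<rightarrow> Y"
    using g(1) y(1) by (auto simp: g'_def)
  ultimately show ?case
    by blast
qed

section \<open>From a labelling to lists that admit no colouring\<close>

text \<open>Otherwise every \<open>y\<close> in \<open>B0\<close> has a listed colour that
  \<open>h\<close> does not use on \<open>A0\<close>, and these colours together with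
  \<open>h\<close> properly colour the complete bipartite graph from \<open>L\<close>.\<close>

lemma complete_bipartite_blocked:
  assumes G0: "complete_bipartite_graph A0 B0 E0"
    and bad: "\<nexists>c. proper_colouring E0 c \<and> (\<forall>v\<in>A0 \<union> B0. c v \<in> L v)"
    and h: "\<And>x. x \<in> A0 \<Longrightarrow> h x \<in> L x"
  shows "\<exists>y\<in>B0. L y \<subseteq> h ` A0"
proof (rule ccontr)
  assume "\<not> ?thesis"
  then have "\<forall>y\<in>B0. \<exists>k. k \<in> L y \<and> k \<notin> h ` A0"
    by blast
  then obtain d where d: "\<forall>y\<in>B0. d y \<in> L y \<and> d y \<notin> h ` A0"
    by metis
  define c where "c v = (if v \<in> A0 then h v else d v)" for v
  have disj: "A0 \<inter> B0 = {}" and E0: "E0 = bipartite_edges A0 B0"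
    using G0 by (auto simp: complete_bipartite_graph_def bipartite_graph_def)
  have cross: "c u \<noteq> c v" if "u \<in> A0" "v \<in> B0" for u v
    proof -
    have "v \<notin> A0" "d v \<notin> h ` A0"
      using that disj d by blast+
    with that(1) have "h u \<noteq> d v"
      by (metis imageI)
    with that(1) \<open>v \<notin> A0\<close> show ?thesis
      by (simp add: c_def)
  qed
  have "proper_colouring E0 c"
    unfolding proper_colouring_def E0 bipartite_edges_def
    by (auto simp: doubleton_eq_iff dest: cross cross[THEN not_sym])
  moreover have "\<forall>v\<in>A0 \<union> B0. c v \<in> L v"
    using h d by (auto simp: c_def)
  ultimately show False
    using bad by blast
qed

lemma degree_le_card_neighbours:
  assumes G: "bipartite_graph A B E" and "w \<in> B"
  shows "degree E w \<le> card {v \<in> A. {v, w} \<in> E}"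
proof -
  have "{e \<in> E. w \<in> e} \<subseteq> (\<lambda>v. {v, w}) ` {v \<in> A. {v, w} \<in> E}"
    using assms by (auto simp: bipartite_graph_def bipartite_edges_def)
  moreover have "finite {v \<in> A. {v, w} \<in> E}"
    using G by (simp add: bipartite_graph_def)
  ultimately show ?thesis
    unfolding degree_def by (rule surj_card_le[rotated])
qed

text \<open>The deterministic half: by \<open>few\<close>, the labelled vertices have fewer than
  \<open>exp (g / card B0)\<close> colourings, with \<open>g\<close> the number of good vertices, so
  greedily chosen lists on the good vertices kill them all.\<close>

lemma labelled_neighbourhoods_block:
  assumes G0: "complete_bipartite_graph A0 B0 E0"
    and L0: "list_assignment A0 B0 kA kB L0"
    and bad: "\<nexists>c. proper_colouring E0 c \<and> (\<forall>v\<in>A0 \<union> B0. c v \<in> L0 v)"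
    and fin: "finite A" "finite B"
    and f: "f \<in> A \<rightarrow> insert None (Some ` A0)"
    and kA: "0 < kA"
    and few: "ln kA * card {v \<in> A. f v \<noteq> None}
      < card {w \<in> B. \<forall>x\<in>A0. \<exists>v\<in>A. {v, w} \<in> E \<and> f v = Some x} / card B0"
    and disj: "A \<inter> B = {}"
  shows "\<not> choosable A B E kA kB"
proof
  define A' where "A' = {v \<in> A. f v \<noteq> None}"
  define W where "W = {w \<in> B. \<forall>x\<in>A0. \<exists>v\<in>A. {v, w} \<in> E \<and> f v = Some x}"
  define M where "M v = L0 (the (f v))" for v
  define C where "C = (\<Pi>\<^sub>E v\<in>A'. M v)"
  \<comment> \<open>Under \<open>c\<close> the labelled neighbours of \<open>w\<close> use up the
    whole list of \<open>y\<close>, so \<open>w\<close> cannot be coloured from it.\<close>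
  define K where "K c w y \<longleftrightarrow> L0 y \<subseteq> c ` {v \<in> A'. {v, w} \<in> E}" for c w y
  have finW: "finite W" and finA': "finite A'"
    using fin by (auto simp: W_def A'_def)
  have finB0: "finite B0"
    using G0 by (auto simp: complete_bipartite_graph_def bipartite_graph_def)
  have lists: "colour_list kA (M v)" if "v \<in> A'" for v
    proof -
    have "f v \<in> insert None (Some ` A0)" "f v \<noteq> None"
      using that f by (auto simp: A'_def)
    then show ?thesis
      using L0 by (auto simp: M_def list_assignment_def)
  qed
  have finC: "finite C"
    unfolding C_def using lists finA' by (intro finite_PiE) (auto simp: colour_list_def)
  have cardC: "card C = kA ^ card A'"
    unfolding C_def using lists finA' by (simp add: card_PiE colour_list_def)
  \<comment> \<open>If \<open>card B0 = 0\<close>, the quotient in \<open>few\<close> is 0 by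
    convention, but the left side is nonnegative.\<close>
  have B0: "0 < card B0"
    using few kA by (cases "card B0 = 0") (auto simp: mult_less_0_iff)
  have K: "\<exists>y\<in>B0. K c w y" if c: "c \<in> C" and w: "w \<in> W" for c w
  proof -
    \<comment> \<open>A neighbour \<open>n x\<close> of \<open>w\<close> labelled \<open>x\<close>
      for each \<open>x\<close>: composing \<open>c\<close> with \<open>n\<close> selects a colour
      from every list on \<open>A0\<close>.\<close>
    obtain n where n: "\<forall>x\<in>A0. n x \<in> A \<and> {n x, w} \<in> E \<and> f (n x) = Some x"
      using w unfolding W_def by (simp add: bchoice) metis
    have "c (n x) \<in> L0 x" if "x \<in> A0" for x
    proof -
      have "n x \<in> A'" "M (n x) = L0 x"
        using n that by (auto simp: A'_def M_def)
      then show ?thesis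
        using c by (auto simp: C_def)
    qed
    from complete_bipartite_blocked[OF G0 bad, of "\<lambda>x. c (n x)"] this
    obtain y where y: "y \<in> B0" "L0 y \<subseteq> (\<lambda>x. c (n x)) ` A0"
      by blast
    have "(\<lambda>x. c (n x)) ` A0 \<subseteq> c ` {v \<in> A'. {v, w} \<in> E}"
      using n by (auto simp: A'_def)
    with y show ?thesis
      unfolding K_def by blast
  qed
  obtain g where g: "g \<in> W \<rightarrow> B0" and surv: "real (card {c \<in> C. \<forall>w\<in>W. \<not> K c w (g w)})
      \<le> (1 - 1 / card B0) ^ card W * card C"
    using greedy_cover[OF finW finC finB0 _ K] B0 by force
  have "(1 - 1 / card B0) ^ card W \<le> exp (- 1 / card B0) ^ card W"
    using B0 exp_ge_add_one_self[of "- 1 / card B0"] by (intro power_mono) auto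
  also have "\<dots> = exp (- (card W / card B0))"
    by (simp flip: exp_of_nat_mult)
  finally have "(1 - 1 / card B0) ^ card W * card C \<le> exp (- (card W / card B0)) * card C"
    by (rule mult_right_mono) simp
  also have "exp (- (card W / card B0)) * card C
      = exp (- (card W / card B0)) * exp (ln kA * card A')"
    using kA by (simp add: cardC exp_of_nat2_mult)
  also have "exp (- (card W / card B0)) * exp (ln kA * card A') < 1"
    using few by (simp flip: exp_add add: A'_def W_def)
  \<comment> \<open>A natural number below 1 is 0.\<close>
  finally have "card {c \<in> C. \<forall>w\<in>W. \<not> K c w (g w)} = 0"
    using surv by simp
  then have killed: "\<exists>w\<in>W. K c w (g w)" if "c \<in> C" for c
    using that finC by auto

  \<comment> \<open>Vertices neither labelled nor good get arbitrary lists of the right size,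
    starting at 1 since colours are positive.\<close>
  define L where "L v = (if v \<in> A' then M v else if v \<in> W then L0 (g v)
    else if v \<in> A then {1..kA} else {1..kB})" for v
  have "list_assignment A B kA kB L"
    unfolding list_assignment_def
  proof (intro conjI ballI)
    fix v assume "v \<in> A"
    then show "colour_list kA (L v)"
      using lists disj by (auto simp: L_def W_def) (auto simp: colour_list_def)
  next
    fix v assume v: "v \<in> B"
    then have "v \<notin> A"
      using disj by blast
    moreover have "colour_list kB (L0 (g v))" if "v \<in> W"
      using that g L0 by (auto simp: list_assignment_def)
    ultimately show "colour_list kB (L v)"
      by (auto simp: L_def A'_def) (auto simp: colour_list_def)
  qed
  moreover assume "choosable A B E kA kB"
  ultimately obtain c where c: "proper_colouring E c" "\<forall>v\<in>A \<union> B. c v \<in> L v"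
    unfolding choosable_def by blast
  \<comment> \<open>The restriction makes \<open>c\<close> extensional, as membership in
    \<open>C\<close> demands.\<close>
  have "restrict c A' \<in> C"
  proof -
    have "c v \<in> M v" if "v \<in> A'" for v
      using c(2) that by (force simp: A'_def L_def)
    then show ?thesis
      by (auto simp: C_def)
  qed
  from killed[OF this] obtain w where w: "w \<in> W" "K (restrict c A') w (g w)"
    by blast
  have "w \<in> B" "w \<notin> A'"
    using w(1) disj by (auto simp: W_def A'_def)
  then have "c w \<in> L0 (g w)"
    using c(2) w(1) by (force simp: L_def)
  then obtain v where "v \<in> A'" "{v, w} \<in> E" "c w = c v"
    using w(2) by (auto simp: K_def)
  with c(1) show False
    unfolding proper_colouring_def by metis
qed

section \<open>Choice of the labelling probability\<close>

theorem theorem9p1: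
  fixes A0 B0 :: "'v set" and E0 :: "'v set set"
    and A B :: "'w set" and E :: "'w set set"
    and a b kA kB :: nat and \<delta>B :: real
  assumes G0: "complete_bipartite_graph A0 B0 E0"
    and card_A0: "card A0 = a"
    and card_B0: "card B0 = b"
    and not_choosable: "\<not> choosable A0 B0 E0 kA kB"
    and kA: "2 \<le> kA"
    and G: "bipartite_graph A B E"
    and nonempty: "A \<union> B \<noteq> {}"
    and card_le: "card A \<le> card B"
    and deg: "\<forall>v\<in>B. \<delta>B \<le> real (degree E v)"
    and \<delta>B: "\<delta>B > 4 * real a * real b * ln (4 * real a) * ln (real kA)"
  shows "\<not> choosable A B E kA kB"
proof -
  obtain L0 where L0: "list_assignment A0 B0 kA kB L0"
    and bad: "\<nexists>c. proper_colouring E0 c \<and> (\<forall>v\<in>A0 \<union> B0. c v \<in> L0 v)"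
    using not_choosable unfolding choosable_def by blast
  have fin0: "finite A0" "finite B0"
    using G0 by (auto simp: complete_bipartite_graph_def bipartite_graph_def)
  have fin: "finite A" "finite B" and disj: "A \<inter> B = {}"
    using G by (auto simp: bipartite_graph_def)
  have B: "0 < card B"
    using nonempty card_le fin by (metis Un_empty card_0_eq gr0I le_zero_eq)
  \<comment> \<open>A choice \<open>h\<close> from the lists on \<open>A0\<close> exists, and it
    blocks some vertex of \<open>B0\<close>; so \<open>b\<close> is positive.\<close>
  have "\<forall>x\<in>A0. \<exists>k. k \<in> L0 x"
  proof
    fix x assume "x \<in> A0"
    then have "card (L0 x) = kA"
      using L0 by (auto simp: list_assignment_def colour_list_def)
    then show "\<exists>k. k \<in> L0 x"
      using kA by (cases "L0 x = {}") auto
  qed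
  then obtain h where "\<forall>x\<in>A0. h x \<in> L0 x"
    by metis
  with complete_bipartite_blocked[OF G0 bad, of h] have "B0 \<noteq> {}"
    by blast
  then have b: "0 < b"
    using fin0 card_B0 by (metis card_gt_0_iff)
  define N where "N w = {v \<in> A. {v, w} \<in> E}" for w
  have "\<exists>f\<in>A \<rightarrow> insert None (Some ` A0). ln kA * card {v \<in> A. f v \<noteq> None}
      < card {w \<in> B. \<forall>x\<in>A0. \<exists>v\<in>A. {v, w} \<in> E \<and> f v = Some x} / card B0"
  proof (cases "a = 0")
    case True
    \<comment> \<open>Without labels every vertex of \<open>B\<close> is vacuously good, and the
      claim reads \<open>0 < card B / b\<close>.\<close>
    then show ?thesis
      using fin0 card_A0 card_B0 B b by (intro bexI[of _ "\<lambda>_. None"]) auto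
  next
    case False
    then have a: "1 \<le> real a" "A0 \<noteq> {}"
      using card_A0 by auto
    have lnk: "1 / 2 \<le> ln (real kA)"
      using kA exp_half_le2 by (subst ln_ge_iff) linarith+
    \<comment> \<open>This makes \<open>ln kA\<close> times the mean number of labelled vertices
      equal to \<open>card A / (4 * b)\<close>. Since \<open>ln kA\<close> is at least 1/2 and
      \<open>b\<close> at least 1, \<open>p\<close> is a probability.\<close>
    define p where "p = 1 / (4 * b * ln kA)"
    have "1 \<le> real b"
      using b by simp
    then have "1 * (1 / 2) \<le> b * ln kA"
      using lnk by (intro mult_mono) auto
    then have p: "0 < p" "p \<le> 1"
      using b lnk by (auto simp: p_def)
    \<comment> \<open>The degree bound times \<open>p / a\<close> is \<open>ln (4 * a)\<close>, so a
      given label misses \<open>N w\<close> with probability at most \<open>1 / (4 * a)\<close>;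
      summing over the \<open>a\<close> labels will give 1/4.\<close>
    have "exp (- (p / a * card (N w))) \<le> 1 / (4 * a)" if "w \<in> B" for w
    proof -
      have "real (degree E w) \<le> card (N w)"
        unfolding N_def using degree_le_card_neighbours[OF G that] by simp
      then have "4 * a * b * ln (4 * a) * ln kA \<le> card (N w)"
        using deg that \<delta>B by fastforce
      then have "ln (4 * a) \<le> p / a * card (N w)"
        using a b lnk by (simp add: p_def field_simps)
      then have "exp (- (p / a * card (N w))) \<le> exp (- ln (4 * a))"
        by simp
      then show ?thesis
        using a by (simp add: exp_minus inverse_eq_divide)
    qed
    moreover have "(1 - p / a) ^ n \<le> exp (- (p / a * n))" for n :: nat
    proof -
      have "p / a \<le> 1"
        using p a by simp
      then have "(1 - p / a) ^ n \<le> exp (- (p / a)) ^ n"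
        using exp_ge_add_one_self[of "- (p / a)"] by (intro power_mono) auto
      also have "\<dots> = exp (- (p / a * n))"
        by (simp add: mult.commute flip: exp_of_nat_mult)
      finally show ?thesis .
    qed
    ultimately have "(1 - p / a) ^ card (N w) \<le> 1 / (4 * a)" if "w \<in> B" for w
      using that order_trans by blast
    then have "a * (1 - p / a) ^ card (N w) \<le> 1 / 4" if "w \<in> B" for w
      using that a by (simp add: field_simps)
    then have "(\<Sum>w\<in>B. a * (1 - p / a) ^ card (N w)) \<le> (\<Sum>w\<in>B. 1 / 4)"
      by (rule sum_mono)
    then have missing: "(\<Sum>w\<in>B. a * (1 - p / a) ^ card (N w)) \<le> card B / 4"
      by simp
    have labelled: "ln kA * (p * card A) \<le> card B / (4 * b)"
      using lnk b card_le by (simp add: p_def divide_right_mono)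
    have "N w \<subseteq> A" for w
      by (auto simp: N_def)
    then obtain f where f: "f \<in> A \<rightarrow>\<^sub>E insert None (Some ` A0)"
      and le: "ln kA * card {v \<in> A. f v \<noteq> None}
        + 1 / b * card {w \<in> B. \<exists>x\<in>A0. \<forall>v\<in>N w. f v \<noteq> Some x}
        \<le> ln kA * (p * card A) + 1 / b * (\<Sum>w\<in>B. a * (1 - p / a) ^ card (N w))"
      using ex_partial_labelling[OF fin fin0(1) a(2), of N p "1 / b" "ln kA"] p card_A0 by auto
    define bad_B where "bad_B = {w \<in> B. \<exists>x\<in>A0. \<forall>v\<in>N w. f v \<noteq> Some x}"
    define good_B where "good_B = {w \<in> B. \<forall>x\<in>A0. \<exists>v\<in>A. {v, w} \<in> E \<and> f v = Some x}"
    have "B = bad_B \<union> good_B" "bad_B \<inter> good_B = {}"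
      by (auto simp: bad_B_def good_B_def N_def)
    then have "card B = card bad_B + card good_B"
      using fin(2) by (metis card_Un_disjoint finite_Un)
    then have split: "real (card B) / b = card bad_B / b + card good_B / b"
      by (simp add: add_divide_distrib)
    \<comment> \<open>Labelled and bad vertices each account for at most a quarter of
      \<open>card B / b\<close>; comparison with \<open>split\<close> cancels the bad share and
      leaves the good one.\<close>
    have "1 / b * (\<Sum>w\<in>B. a * (1 - p / a) ^ card (N w)) \<le> 1 / b * (card B / 4)"
      using missing by (intro mult_left_mono) auto
    with le labelled
    have "ln kA * card {v \<in> A. f v \<noteq> None} + card bad_B / b \<le> card B / b / 2"
      by (simp add: bad_B_def)
    also have "\<dots> < card B / b"
      using B b by (simp add: field_simps)
    finally have "ln kA * card {v \<in> A. f v \<noteq> None} < card good_B / b"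
      unfolding split by simp
    then show ?thesis
      using f unfolding good_B_def card_B0 by (intro bexI[of _ f]) auto
  qed
  then show ?thesis
    using labelled_neighbourhoods_block[OF G0 L0 bad fin] kA disj by auto
qed

end
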